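(* Let $p>1$ be an integer. Let $G$ be a simple graph with $n\geq 4$ vertices and $m$ edges which contains no cycle $C_4$ of length $4$ as a subgraph and has minimum degree $\delta(G)\geq 1$. If $m\leq \lfloor 3(n-1)/2\rfloor$, then $e_p(G)\leq e_p(F_n)$, with equality if and only if $G\cong F_n$.
   Context: All graphs are finite, undirected and simple. For a graph $G$ with vertex degrees $d_G(v)$, the degree power is $e_p(G)=\sum_{v\in V(G)} d_G(v)^p$. The friendship graph $F_n$ is the graph obtained from the star $S_n$ on $n$ vertices by adding a maximum matching on the set of its leaves; it has $\lfloor 3(n-1)/2\rfloor$ edges. *)

theory Defs
  imports Main
begin

type_synonym 'a ugraph = "'a set \<times> 'a set set"

abbreviation verts :: "'a ugraph \<Rightarrow> 'a set" where
  "verts G \<equiv> fst G"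

abbreviation edges :: "'a ugraph \<Rightarrow> 'a set set" where
  "edges G \<equiv> snd G"

definition simple_graph :: "'a ugraph \<Rightarrow> bool" where
  "simple_graph G \<longleftrightarrow> finite (verts G) \<and> (\<forall>e\<in>edges G. e \<subseteq> verts G \<and> card e = 2)"

definition degree :: "'a ugraph \<Rightarrow> 'a \<Rightarrow> nat" where
  "degree G v = card {e \<in> edges G. v \<in> e}"

definition min_degree :: "'a ugraph \<Rightarrow> nat" where
  "min_degree G = Min (degree G ` verts G)"

definition degree_power :: "nat \<Rightarrow> 'a ugraph \<Rightarrow> nat" where
  "degree_power p G = (\<Sum>v\<in>verts G. degree G v ^ p)"

definition graph_iso :: "'a ugraph \<Rightarrow> 'b ugraph \<Rightarrow> bool" where
  "graph_iso G H \<longleftrightarrow> (\<exists>f. bij_betw f (verts G) (verts H) \<and>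
     (\<forall>u\<in>verts G. \<forall>v\<in>verts G. {u, v} \<in> edges G \<longleftrightarrow> {f u, f v} \<in> edges H))"

text \<open>The subgraph relation below is not necessarily induced.\<close>

definition contains_subgraph :: "'a ugraph \<Rightarrow> 'b ugraph \<Rightarrow> bool" where
  "contains_subgraph G H \<longleftrightarrow> (\<exists>f. inj_on f (verts H) \<and> f ` verts H \<subseteq> verts G \<and>
     (\<forall>e\<in>edges H. f ` e \<in> edges G))"

definition cycle_graph :: "nat \<Rightarrow> nat ugraph" where
  "cycle_graph k = ({..<k}, {{i, Suc i mod k} |i. i < k})"

definition star_graph :: "nat \<Rightarrow> nat ugraph" where
  "star_graph n = ({..<n}, {{0, v} |v. v \<in> {1..<n}})"

definition matching_on :: "'a set \<Rightarrow> 'a set set \<Rightarrow> bool" where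
  "matching_on L M \<longleftrightarrow> (\<forall>e\<in>M. e \<subseteq> L \<and> card e = 2) \<and>
     (\<forall>e\<in>M. \<forall>e'\<in>M. e \<noteq> e' \<longrightarrow> e \<inter> e' = {})"

text \<open>The matching \<open>{1,2}, {3,4}, \<dots>\<close> on the leaves \<open>1, \<dots>, n - 1\<close> of the star. It is maximum
  (see \<open>leaf_matching_maximum\<close>); any other maximum matching on the leaves differs from it
  only by a permutation of the leaves, so the graph \<open>friendship_graph n\<close> is determined up to
  isomorphism.\<close>

definition leaf_matching :: "nat \<Rightarrow> nat set set" where
  "leaf_matching n = {{2 * i + 1, 2 * i + 2} |i. 2 * i + 2 < n}"

definition friendship_graph :: "nat \<Rightarrow> nat ugraph" where
  "friendship_graph n = (verts (star_graph n), edges (star_graph n) \<union> leaf_matching n)"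

lemma leaf_matching_image:
  "leaf_matching n = (\<lambda>i. {2 * i + 1, 2 * i + 2}) ` {..<(n - 1) div 2}"
  unfolding leaf_matching_def by (auto simp: image_iff)

lemma card_leaf_matching: "card (leaf_matching n) = (n - 1) div 2"
proof -
  have "inj_on (\<lambda>i::nat. {2 * i + 1, 2 * i + 2}) {..<(n - 1) div 2}"
    by (rule inj_onI) (auto simp: doubleton_eq_iff)
  then show ?thesis
    unfolding leaf_matching_image by (simp add: card_image)
qed

lemma leaf_matching_matching: "matching_on {1..<n} (leaf_matching n)"
  unfolding matching_on_def leaf_matching_def by (auto; presburger)

lemma leaf_matching_maximum:
  assumes "matching_on {1..<n} M"
  shows "card M \<le> card (leaf_matching n)"
proof -
  have fin: "finite M"
    by (rule finite_subset[of _ "Pow {1..<n}"]) (use assms in \<open>auto simp: matching_on_def\<close>)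
  have sub: "\<Union>M \<subseteq> {1..<n}"
    using assms by (auto simp: matching_on_def)
  then have "finite (\<Union>M)"
    by (rule finite_subset) simp
  then have "2 * card M = card (\<Union>M)"
    by (intro card_partition) (use assms fin in \<open>auto simp: matching_on_def\<close>)
  also have "\<dots> \<le> card {1..<n}"
    by (rule card_mono) (use sub in auto)
  finally show ?thesis
    by (simp add: card_leaf_matching)
qed

lemma card_edges_friendship_graph:
  "card (edges (friendship_graph n)) = 3 * (n - 1) div 2"
proof -
  have star: "edges (star_graph n) = (\<lambda>v. {0, v}) ` {1..<n}"
    by (auto simp: star_graph_def)
  have "inj_on (\<lambda>v::nat. {0, v}) {1..<n}"
    by (rule inj_onI) (auto simp: doubleton_eq_iff)
  then have c: "card (edges (star_graph n)) = n - 1"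
    unfolding star by (simp add: card_image)
  have "edges (star_graph n) \<inter> leaf_matching n = {}"
    unfolding star leaf_matching_def by (auto simp: doubleton_eq_iff)
  then have "card (edges (star_graph n) \<union> leaf_matching n) = (n - 1) + (n - 1) div 2"
    using c card_leaf_matching
    by (subst card_Un_disjoint) (auto simp: star leaf_matching_image)
  then show ?thesis
    by (simp add: friendship_graph_def)
qed

lemma simple_graph_friendship_graph: "simple_graph (friendship_graph n)"
  unfolding simple_graph_def friendship_graph_def star_graph_def leaf_matching_def
  by auto

end

theory Submission
  imports Defs
begin

text \<open>
  Interpolating \<open>x ^ p\<close> at 1, 2 and \<open>n - 1\<close>, the degrees occurring in the friendship graph, bounds
  \<open>d ^ p\<close> on \<open>{1..n - 1}\<close> by a combination of 1, \<open>d - 1\<close> and \<open>(d - 1) (d - 2)\<close> with positive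
  coefficients at the last two. Hence it suffices to bound the number of edges and to show that
  \<open>\<Sum> (d - 1) (d - 2) \<le> (n - 2) (n - 3)\<close>.

  Without 4-cycles, \<open>\<Sum> d (d - 1)\<close> counts the ordered pairs of vertices with a common neighbour, so
  the second inequality says that \<open>m - t + f / 3 \<ge> n - 1\<close>, where \<open>t\<close> is the number of triangles and
  \<open>f\<close> the number of pairs at distance at least 3. Triangles are pairwise edge-disjoint and each has
  an edge outside a given spanning forest, so \<open>m - t \<ge> n - k\<close> for \<open>k\<close> components, while
  \<open>f \<ge> 4 (k - 1)\<close> since no vertex is isolated.

  In case of equality the diameter is at most 2, and for every breadth-first tree each other edge
  closes a triangle with two tree edges. Rooting the tree at a vertex of maximum degree forces this
  vertex to be adjacent to all others; the remaining edges then form a maximum matching.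
\<close>

section \<open>Neighbourhoods and handshakes\<close>

definition nbrs :: "'a ugraph \<Rightarrow> 'a \<Rightarrow> 'a set" where
  "nbrs G v = {w. {v, w} \<in> edges G}"

lemma simple_graph_edgeD:
  assumes "simple_graph G" "{x, y} \<in> edges G"
  shows "x \<in> verts G" "y \<in> verts G" "x \<noteq> y"
proof -
  have *: "{x, y} \<subseteq> verts G" "card {x, y} = 2"
    using assms unfolding simple_graph_def by blast+
  then show "x \<in> verts G" "y \<in> verts G" by auto
  show "x \<noteq> y" using * by auto
qed

lemma finite_verts: "simple_graph G \<Longrightarrow> finite (verts G)"
  by (simp add: simple_graph_def)

lemma finite_edges: "simple_graph G \<Longrightarrow> finite (edges G)"
  by (rule finite_subset[of _ "Pow (verts G)"]) (auto simp: simple_graph_def)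

lemma nbrs_subset: "simple_graph G \<Longrightarrow> nbrs G v \<subseteq> verts G - {v}"
  using simple_graph_edgeD[of G v] unfolding nbrs_def by blast

lemma finite_nbrs: "simple_graph G \<Longrightarrow> finite (nbrs G v)"
  by (meson finite_Diff finite_subset finite_verts nbrs_subset)

lemma degree_eq_card_nbrs:
  assumes "simple_graph G"
  shows "degree G v = card (nbrs G v)"
proof -
  have "{e \<in> edges G. v \<in> e} = (\<lambda>w. {v, w}) ` nbrs G v"
  proof
    show "{e \<in> edges G. v \<in> e} \<subseteq> (\<lambda>w. {v, w}) ` nbrs G v"
    proof
      fix e assume e: "e \<in> {e \<in> edges G. v \<in> e}"
      then have "card e = 2" using assms by (auto simp: simple_graph_def)
      then obtain w where "e = {v, w}"
        using e by (auto simp: card_2_iff doubleton_eq_iff)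
      then show "e \<in> (\<lambda>w. {v, w}) ` nbrs G v" using e by (auto simp: nbrs_def)
    qed
  qed (auto simp: nbrs_def)
  moreover have "inj_on (\<lambda>w. {v, w}) (nbrs G v)"
    by (rule inj_onI) (auto simp: doubleton_eq_iff)
  ultimately show ?thesis by (simp add: degree_def card_image)
qed

lemma sum_degree:
  assumes "simple_graph G"
  shows "(\<Sum>v\<in>verts G. degree G v) = 2 * card (edges G)"
proof -
  have "(\<Sum>v\<in>verts G. card {e \<in> edges G. v \<in> e}) = 2 * card (edges G)"
  proof (rule sum_multicount)
    show "\<forall>e\<in>edges G. card {v \<in> verts G. v \<in> e} = 2"
    proof
      fix e assume "e \<in> edges G"
      then have "{v \<in> verts G. v \<in> e} = e" "card e = 2"
        using assms by (auto simp: simple_graph_def)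
      then show "card {v \<in> verts G. v \<in> e} = 2" by simp
    qed
  qed (simp_all add: finite_verts[OF assms] finite_edges[OF assms])
  then show ?thesis by (simp add: degree_def)
qed

lemma degree_less_card:
  assumes "simple_graph G" "v \<in> verts G"
  shows "degree G v < card (verts G)"
proof -
  have "card (nbrs G v) \<le> card (verts G - {v})"
    by (rule card_mono) (simp_all add: finite_verts[OF assms(1)] nbrs_subset[OF assms(1)])
  also have "\<dots> < card (verts G)"
    using assms(2) by (intro psubset_card_mono) (auto simp: finite_verts[OF assms(1)])
  finally show ?thesis using assms by (simp add: degree_eq_card_nbrs)
qed

lemma graph_iso_degree_power:
  assumes "simple_graph G" "simple_graph H" "graph_iso G H"
  shows "degree_power p G = degree_power p H"
proof -
  obtain f where f: "bij_betw f (verts G) (verts H)"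
    and e: "\<And>u v. u \<in> verts G \<Longrightarrow> v \<in> verts G \<Longrightarrow> {u, v} \<in> edges G \<longleftrightarrow> {f u, f v} \<in> edges H"
    using assms(3) unfolding graph_iso_def by blast
  have "degree G v = degree H (f v)" if v: "v \<in> verts G" for v
  proof -
    have "nbrs H (f v) = f ` nbrs G v"
    proof
      show "nbrs H (f v) \<subseteq> f ` nbrs G v"
      proof
        fix w assume w: "w \<in> nbrs H (f v)"
        then have "w \<in> verts H" using nbrs_subset[OF assms(2)] by blast
        then obtain u where "u \<in> verts G" "w = f u"
          using f by (auto simp: bij_betw_def)
        then show "w \<in> f ` nbrs G v" using w e v by (auto simp: nbrs_def)
      qed
      show "f ` nbrs G v \<subseteq> nbrs H (f v)"
        using e[OF v] simple_graph_edgeD(2)[OF assms(1)] unfolding nbrs_def by blast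
    qed
    moreover have "inj_on f (nbrs G v)"
      using f nbrs_subset[OF assms(1), of v] by (meson Diff_subset bij_betw_def inj_on_subset)
    ultimately show ?thesis
      using assms by (simp add: degree_eq_card_nbrs card_image)
  qed
  then show ?thesis
    unfolding degree_power_def using f by (simp add: sum.reindex_bij_betw[OF f, symmetric])
qed

section \<open>Degree powers in the Newton basis at the nodes 1, 2\<close>

text \<open>\<open>newton_coeff k d\<close> is the divided difference of \<open>x \<mapsto> x ^ (k + 2)\<close> at the nodes 1, 2, \<open>d\<close>.\<close>

fun newton_coeff :: "nat \<Rightarrow> int \<Rightarrow> int" where
  "newton_coeff 0 d = 1"
| "newton_coeff (Suc k) d = d * newton_coeff k d + 2 ^ (k + 2) - 1"

text \<open>Newton form, with slope \<open>2 ^ (k + 2) - 1\<close> between the nodes 1 and 2. The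
  induction multiplies by \<open>d\<close> and rewrites \<open>d * (d - 1)\<close> as
  \<open>2 * (d - 1) + (d - 1) * (d - 2)\<close>.\<close>

lemma power_newton:
  "d ^ (k + 2) = 1 + (2 ^ (k + 2) - 1) * (d - 1) + newton_coeff k d * ((d - 1) * (d - 2))"
proof (induction k)
  case 0
  show ?case by (simp add: power2_eq_square algebra_simps)
next
  case (Suc k)
  have "d ^ (Suc k + 2) = d * d ^ (k + 2)" by simp
  also have "\<dots> = d * (1 + (2 ^ (k + 2) - 1) * (d - 1) + newton_coeff k d * ((d - 1) * (d - 2)))"
    by (simp only: Suc)
  also have "\<dots> = 1 + (2 * 2 ^ (k + 2) - 1) * (d - 1)
      + (d * newton_coeff k d + 2 ^ (k + 2) - 1) * ((d - 1) * (d - 2))"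
    by (simp only: algebra_simps)
  finally show ?case by simp
qed

text \<open>Used for multiplying inequalities in \<open>newton_coeff_mono\<close> and, at
  \<open>d = n - 1\<close>, for cancelling the coefficient in the equality case.\<close>

lemma newton_coeff_pos: "0 \<le> d \<Longrightarrow> 1 \<le> newton_coeff k d"
proof (induction k)
  case (Suc k)
  have "(1::int) \<le> 2 ^ (k + 1)" by (rule one_le_power) simp
  then have "(2::int) \<le> 2 ^ (k + 2)" by simp
  moreover have "0 \<le> d * newton_coeff k d" using Suc by simp
  ultimately show ?case unfolding newton_coeff.simps by linarith
qed simp

lemma newton_coeff_mono: "0 \<le> d \<Longrightarrow> d \<le> D \<Longrightarrow> newton_coeff k d \<le> newton_coeff k D"
proof (induction k)
  case (Suc k)
  have "d * newton_coeff k d \<le> D * newton_coeff k D"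
    using Suc newton_coeff_pos[of d k] by (intro mult_mono) auto
  then show ?case by simp
qed simp

text \<open>Each summand vanishes exactly at degrees 1 and 2, the leaf degrees of the friendship
  graph. Integers avoid truncated subtraction.\<close>

definition excess :: "'a ugraph \<Rightarrow> int" where
  "excess G = (\<Sum>v\<in>verts G. (int (degree G v) - 1) * (int (degree G v) - 2))"

lemma degree_power_newton:
  assumes "simple_graph G"
  shows "int (degree_power (k + 2) G) =
    int (card (verts G)) + (2 ^ (k + 2) - 1) * (2 * int (card (edges G)) - int (card (verts G))) +
    (\<Sum>v\<in>verts G. newton_coeff k (int (degree G v)) *
       ((int (degree G v) - 1) * (int (degree G v) - 2)))"
proof -
  have "(\<Sum>v\<in>verts G. int (degree G v) - 1) = 2 * int (card (edges G)) - int (card (verts G))"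
    using sum_degree[OF assms] by (simp add: sum_subtractf flip: of_nat_sum)
  moreover have "int (degree_power (k + 2) G) = (\<Sum>v\<in>verts G. int (degree G v) ^ (k + 2))"
    by (simp add: degree_power_def)
  ultimately show ?thesis
    by (simp only: power_newton[of "int (degree G v)" for v] sum.distrib
        sum_distrib_left[symmetric]) simp
qed

text \<open>Degrees are at most \<open>card (verts G) - 1\<close>, so by monotonicity every Newton
  coefficient can be replaced by its value there; the factor \<open>(d - 1) * (d - 2)\<close> is
  nonnegative.\<close>

lemma degree_power_le_excess:
  assumes "simple_graph G" "\<And>v. v \<in> verts G \<Longrightarrow> 1 \<le> degree G v"
  shows "int (degree_power (k + 2) G) \<le>
    int (card (verts G)) + (2 ^ (k + 2) - 1) * (2 * int (card (edges G)) - int (card (verts G))) +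
    newton_coeff k (int (card (verts G)) - 1) * excess G"
proof -
  have "newton_coeff k (int (degree G v)) * ((int (degree G v) - 1) * (int (degree G v) - 2))
    \<le> newton_coeff k (int (card (verts G)) - 1) * ((int (degree G v) - 1) * (int (degree G v) - 2))"
    if "v \<in> verts G" for v
  proof (rule mult_right_mono)
    show "newton_coeff k (int (degree G v)) \<le> newton_coeff k (int (card (verts G)) - 1)"
      using degree_less_card[OF assms(1) that] by (intro newton_coeff_mono) auto
    have "degree G v = 1 \<or> degree G v \<ge> 2" using assms(2)[OF that] by auto
    then show "0 \<le> (int (degree G v) - 1) * (int (degree G v) - 2)" by auto
  qed
  then show ?thesis
    unfolding degree_power_newton[OF assms(1)] excess_def sum_distrib_left
    by (intro add_mono sum_mono) auto
qed

section \<open>Degrees of the friendship graph\<close>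

lemma friendship_graph_leaf_degree:
  assumes "v \<in> {1..<n}"
  shows "degree (friendship_graph n) v \<in> {1, 2}"
proof -
  let ?F = "friendship_graph n"
  \<comment> \<open>The matching partner of \<open>v\<close>. If \<open>n\<close> is even, the last
    leaf is unmatched and its \<open>u = n\<close> is no vertex; hence only an inclusion
    follows.\<close>
  define u where "u = (if odd v then v + 1 else v - 1)"
  have "nbrs ?F v \<subseteq> {0, u}"
    unfolding nbrs_def friendship_graph_def star_graph_def leaf_matching_def u_def using assms
    by (auto simp: doubleton_eq_iff)
  then have "card (nbrs ?F v) \<le> card {0, u}" by (intro card_mono) auto
  moreover have "card {0, u} \<le> 2" by (simp add: card_insert_if)
  moreover have "0 \<in> nbrs ?F v"
    using assms unfolding nbrs_def friendship_graph_def star_graph_def by (auto simp: doubleton_eq_iff)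
  then have "card (nbrs ?F v) \<noteq> 0"
    using finite_nbrs[OF simple_graph_friendship_graph, of n v] by (metis card_0_eq empty_iff)
  ultimately show ?thesis
    by (simp add: degree_eq_card_nbrs[OF simple_graph_friendship_graph]) linarith
qed

lemma friendship_graph_centre_degree: "degree (friendship_graph n) 0 = n - 1"
proof -
  have "nbrs (friendship_graph n) 0 = {1..<n}"
    unfolding nbrs_def friendship_graph_def star_graph_def leaf_matching_def
    by (auto simp: doubleton_eq_iff)
  then show ?thesis
    by (simp add: degree_eq_card_nbrs[OF simple_graph_friendship_graph])
qed

text \<open>Leaves contribute nothing to the Newton remainder, and the centre has degree
  \<open>n - 1\<close>, so the bound of \<open>degree_power_le_excess\<close> is attained.\<close>

lemma degree_power_friendship_graph:
  assumes "n \<ge> 1"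
  shows "int (degree_power (k + 2) (friendship_graph n)) =
    int n + (2 ^ (k + 2) - 1) * (2 * int (3 * (n - 1) div 2) - int n) +
    newton_coeff k (int n - 1) * ((int n - 2) * (int n - 3))"
proof -
  let ?F = "friendship_graph n"
  let ?h = "\<lambda>v. newton_coeff k (int (degree ?F v)) *
       ((int (degree ?F v) - 1) * (int (degree ?F v) - 2))"
  have V: "verts ?F = insert 0 {1..<n}"
    using assms by (auto simp: friendship_graph_def star_graph_def)
  have "?h v = 0" if "v \<in> {1..<n}" for v
    using friendship_graph_leaf_degree[OF that] by auto
  then have "(\<Sum>v\<in>{1..<n}. ?h v) = 0" by (rule sum.neutral[OF ballI])
  moreover have "(\<Sum>v\<in>verts ?F. ?h v) = ?h 0 + (\<Sum>v\<in>{1..<n}. ?h v)"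
    unfolding V by (rule sum.insert) auto
  moreover have "?h 0 = newton_coeff k (int n - 1) * ((int n - 2) * (int n - 3))"
    using assms by (simp add: friendship_graph_centre_degree of_nat_diff)
  moreover have "card (verts ?F) = n" unfolding V using assms by simp
  ultimately show ?thesis
    unfolding degree_power_newton[OF simple_graph_friendship_graph]
    by (simp only: card_edges_friendship_graph)
qed

section \<open>Counting pairs in graphs without 4-cycles\<close>

lemma card_off_diagonal:
  assumes "finite A"
  shows "card {(x, y). x \<in> A \<and> y \<in> A \<and> x \<noteq> y} = card A * (card A - 1)"
proof -
  have "{(x, y). x \<in> A \<and> y \<in> A \<and> x \<noteq> y} = Sigma A (\<lambda>x. A - {x})" by auto
  then show ?thesis using assms by (simp add: card_SigmaI)
qed

lemma card_Un3_image_le: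
  assumes "finite A" "finite B" "finite C"
  shows "card (A \<union> f ` B \<union> g ` C) \<le> card A + card B + card C"
  using card_Un_le[of "A \<union> f ` B" "g ` C"] card_Un_le[of A "f ` B"]
    card_image_le[OF assms(2), of f] card_image_le[OF assms(3), of g] by linarith

text \<open>The absence of 4-cycles in the form used for counting: two distinct vertices have at
  most one common neighbour.\<close>

locale c4_free_graph =
  fixes G :: "'a ugraph"
  assumes simple: "simple_graph G"
    and c4_free: "\<lbrakk>x \<noteq> y; {x, u} \<in> edges G; {y, u} \<in> edges G; {x, w} \<in> edges G; {y, w} \<in> edges G\<rbrakk>
      \<Longrightarrow> u = w"
begin

abbreviation adj :: "'a \<Rightarrow> 'a \<Rightarrow> bool" where
  "adj x y \<equiv> {x, y} \<in> edges G"

text \<open>Pairs are ordered throughout: an edge gives two arcs and a triangle six. The arcs lying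
  in triangles are \<open>arcs \<inter> covered\<close>.\<close>

definition arcs :: "('a \<times> 'a) set" where
  "arcs = {(x, y). adj x y}"

definition covered :: "('a \<times> 'a) set" where
  "covered = {(x, y). x \<noteq> y \<and> (\<exists>z. adj x z \<and> adj y z)}"

text \<open>Pairs at distance at least 3, including those in different components.\<close>

definition far :: "('a \<times> 'a) set" where
  "far = {(x, y). x \<in> verts G \<and> y \<in> verts G \<and> x \<noteq> y \<and> (x, y) \<notin> arcs \<and> (x, y) \<notin> covered}"

lemmas adjD = simple_graph_edgeD[OF simple]

lemma arcs_eq_Sigma: "arcs = Sigma (verts G) (nbrs G)"
  using adjD by (auto simp: arcs_def nbrs_def)

lemma finite_arcs: "finite arcs"
  unfolding arcs_eq_Sigma by (intro finite_SigmaI finite_verts finite_nbrs simple)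

lemma covered_subset: "covered \<subseteq> verts G \<times> verts G"
  using adjD by (auto simp: covered_def)

lemma finite_covered: "finite covered"
  using covered_subset finite_verts[OF simple] by (meson finite_SigmaI finite_subset)

lemma finite_far: "finite far"
  by (rule finite_subset[of _ "verts G \<times> verts G"]) (auto simp: far_def finite_verts[OF simple])

lemma card_arcs: "card arcs = 2 * card (edges G)"
  unfolding arcs_eq_Sigma sum_degree[OF simple, symmetric]
  by (simp add: card_SigmaI finite_verts finite_nbrs simple degree_eq_card_nbrs)

text \<open>Count pairs of distinct neighbours at each vertex; no pair is counted twice because its
  common neighbour is unique.\<close>

lemma card_covered: "card covered = (\<Sum>v\<in>verts G. degree G v * (degree G v - 1))"
proof -
  let ?P = "\<lambda>z. {(x, y). x \<in> nbrs G z \<and> y \<in> nbrs G z \<and> x \<noteq> y}"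
  have fin: "finite (?P z)" for z
    by (rule finite_subset[of _ "nbrs G z \<times> nbrs G z"]) (auto simp: finite_nbrs[OF simple])
  have "covered = snd ` Sigma (verts G) ?P"
  proof
    show "covered \<subseteq> snd ` Sigma (verts G) ?P"
    proof
      fix a assume "a \<in> covered"
      then obtain x y z where a: "a = (x, y)" "x \<noteq> y" "adj x z" "adj y z"
        by (auto simp: covered_def)
      then have "(z, a) \<in> Sigma (verts G) ?P"
        using adjD(2) by (auto simp: nbrs_def insert_commute)
      then show "a \<in> snd ` Sigma (verts G) ?P" by force
    qed
    show "snd ` Sigma (verts G) ?P \<subseteq> covered"
      by (auto simp: covered_def nbrs_def insert_commute)
  qed
  moreover have "inj_on snd (Sigma (verts G) ?P)"
  proof (rule inj_onI)
    fix s t assume st: "s \<in> Sigma (verts G) ?P" "t \<in> Sigma (verts G) ?P" "snd s = snd t"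
    obtain z x y where s: "s = (z, x, y)" by (cases s)
    obtain z' where t: "t = (z', x, y)" using st s by (cases t) auto
    have "z = z'"
      by (rule c4_free[of x y]) (use st s t in \<open>auto simp: nbrs_def insert_commute\<close>)
    then show "s = t" using s t by simp
  qed
  ultimately have "card covered = card (Sigma (verts G) ?P)" by (simp add: card_image)
  also have "\<dots> = (\<Sum>v\<in>verts G. card (?P v))"
    using fin by (intro card_SigmaI) (auto simp: finite_verts[OF simple])
  finally show ?thesis
    by (simp add: card_off_diagonal finite_nbrs[OF simple] degree_eq_card_nbrs[OF simple])
qed

lemma card_pairs:
  "card covered + card arcs + card far =
     card (verts G) * (card (verts G) - 1) + card (arcs \<inter> covered)"
proof -
  have "{(x, y). x \<in> verts G \<and> y \<in> verts G \<and> x \<noteq> y} = (arcs \<union> covered) \<union> far"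
    using adjD covered_subset adjD(3)[of x x for x] by (auto simp: far_def arcs_def covered_def)
  then have "card (verts G) * (card (verts G) - 1) = card ((arcs \<union> covered) \<union> far)"
    using card_off_diagonal[OF finite_verts[OF simple]] by simp
  also have "\<dots> = card (arcs \<union> covered) + card far"
    by (rule card_Un_disjoint) (auto simp: finite_arcs finite_covered finite_far, auto simp: far_def)
  finally show ?thesis
    using card_Un_Int[OF finite_arcs finite_covered] by simp
qed

text \<open>Write \<open>(d - 1) * (d - 2)\<close> as \<open>d * (d - 1) - 2 * d + 2\<close>, sum,
  and eliminate \<open>card covered\<close> by \<open>card_pairs\<close>. With t triangles,
  \<open>card (arcs \<inter> covered)\<close> is 6 t.\<close>

lemma excess_eq:
  assumes "verts G \<noteq> {}"
  shows "excess G = (int (card (verts G)) - 2) * (int (card (verts G)) - 3)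
    + int (card (arcs \<inter> covered)) - int (card far)
    - 6 * int (card (edges G)) + 6 * (int (card (verts G)) - 1)"
proof -
  let ?n = "int (card (verts G))"
  \<comment> \<open>The truncation of \<open>d - 1\<close> at 0 is harmless, since the other factor
    is then 0.\<close>
  have *: "int (d * (d - 1)) = int d * (int d - 1)" for d :: nat
    by (cases d) (auto simp: algebra_simps)
  have "excess G = (\<Sum>v\<in>verts G. int (degree G v * (degree G v - 1)) - 2 * int (degree G v) + 2)"
    unfolding excess_def * by (intro sum.cong) (auto simp: algebra_simps)
  also have "\<dots> = int (card covered) - 2 * int (\<Sum>v\<in>verts G. degree G v) + 2 * ?n"
    unfolding card_covered by (simp add: sum.distrib sum_subtractf sum_distrib_left)
  also have "int (\<Sum>v\<in>verts G. degree G v) = 2 * int (card (edges G))"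
    unfolding sum_degree[OF simple] by simp
  finally have "excess G = int (card covered) - 4 * int (card (edges G)) + 2 * ?n" by simp
  moreover have "int (card covered) + 2 * int (card (edges G)) + int (card far) =
     ?n * (?n - 1) + int (card (arcs \<inter> covered))"
    using arg_cong[OF card_pairs, of int] unfolding card_arcs of_nat_add * by simp
  ultimately show ?thesis by (simp add: algebra_simps)
qed

section \<open>Spanning forests and triangles\<close>

text \<open>A spanning forest given by parent pointers with root set \<open>R\<close>. The strictly
  decreasing \<open>lev\<close> excludes cycles; it need not be a distance.\<close>

definition level_forest :: "'a set \<Rightarrow> ('a \<Rightarrow> nat) \<Rightarrow> ('a \<Rightarrow> 'a) \<Rightarrow> bool" where
  "level_forest R lev par \<longleftrightarrow> R \<subseteq> verts G \<and>
     (\<forall>w\<in>verts G - R. adj w (par w) \<and> lev (par w) < lev w)"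

definition tree_arcs :: "'a set \<Rightarrow> ('a \<Rightarrow> 'a) \<Rightarrow> ('a \<times> 'a) set" where
  "tree_arcs R par = (\<lambda>w. (w, par w)) ` (verts G - R) \<union> (\<lambda>w. (par w, w)) ` (verts G - R)"

text \<open>\<open>rot (x, y) = (y, z)\<close> for the triangle \<open>xyz\<close>, which is unique as there is no 4-cycle.\<close>

definition rot :: "'a \<times> 'a \<Rightarrow> 'a \<times> 'a" where
  "rot a = (snd a, THE z. adj (fst a) z \<and> adj (snd a) z)"

lemma rot_eq:
  assumes "x \<noteq> y" "adj x z" "adj y z"
  shows "rot (x, y) = (y, z)"
  unfolding rot_def using assms c4_free[of x y] by (auto intro!: the_equality)

lemma tree_arcs_subset: "level_forest R lev par \<Longrightarrow> tree_arcs R par \<subseteq> arcs"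
  by (auto simp: level_forest_def tree_arcs_def arcs_def insert_commute)

lemma card_tree_arcs:
  assumes "level_forest R lev par"
  shows "card (tree_arcs R par) = 2 * (card (verts G) - card R)"
proof -
  have fin: "finite (verts G - R)" "R \<subseteq> verts G"
    using assms finite_verts[OF simple] by (auto simp: level_forest_def)
  have inj: "inj_on (\<lambda>w. (w, par w)) (verts G - R)" "inj_on (\<lambda>w. (par w, w)) (verts G - R)"
    by (auto intro: inj_onI)
  have disj: "(\<lambda>w. (w, par w)) ` (verts G - R) \<inter> (\<lambda>w. (par w, w)) ` (verts G - R) = {}"
  proof -
    have False if "w \<in> verts G - R" "w' \<in> verts G - R" "w = par w'" "par w = w'" for w w'
    proof -
      have "lev (par w) < lev w" "lev (par w') < lev w'"
        using assms that(1,2) unfolding level_forest_def by blast+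
      then show False using that(3,4) by simp
    qed
    then show ?thesis by blast
  qed
  have "card (verts G - R) = card (verts G) - card R"
    using fin by (meson card_Diff_subset finite_subset finite_verts simple)
  then show ?thesis
    unfolding tree_arcs_def using fin disj inj by (simp add: card_Un_disjoint card_image)
qed

text \<open>In a triangle of tree arcs, the vertex of highest level would have both other vertices
  as its parent.\<close>

lemma tree_arcs_triangle_free:
  assumes "level_forest R lev par"
    and "(x, y) \<in> tree_arcs R par" "(y, z) \<in> tree_arcs R par" "(z, x) \<in> tree_arcs R par"
  shows False
proof -
  have c: "(par a = b \<and> lev b < lev a) \<or> (par b = a \<and> lev a < lev b)"
    if ab: "(a, b) \<in> tree_arcs R par" for a b
    using ab assms(1) unfolding tree_arcs_def level_forest_def by auto
  show False
    using c[OF assms(2)] c[OF assms(3)] c[OF assms(4)] by (metis less_asym less_trans)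
qed

text \<open>\<open>rot\<close> permutes the arcs lying in triangles with orbits of size 3, and every orbit meets the
  complement of the forest.\<close>

lemma triangle_arcs_cover:
  assumes "level_forest R lev par"
  defines "P \<equiv> (arcs - tree_arcs R par) \<inter> covered"
  shows "arcs \<inter> covered \<subseteq> P \<union> rot ` P \<union> (rot \<circ> rot) ` P"
proof
  fix a assume "a \<in> arcs \<inter> covered"
  then obtain x y z where a: "a = (x, y)" "x \<noteq> y" "adj x y" "adj x z" "adj y z"
    by (auto simp: covered_def arcs_def)
  have ne: "y \<noteq> z" "z \<noteq> x" using a adjD(3) by blast+
  have sym: "adj y x" "adj z x" "adj z y" using a by (simp_all add: insert_commute)
  have ac: "(x, y) \<in> arcs \<inter> covered" "(y, z) \<in> arcs \<inter> covered" "(z, x) \<in> arcs \<inter> covered"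
    using a ne sym by (auto simp: arcs_def covered_def)
  have r: "rot (y, z) = (z, x)" "rot (z, x) = (x, y)"
    using ne sym a by (auto intro!: rot_eq)
  consider "(x, y) \<in> P" | "(y, z) \<in> P" | "(z, x) \<in> P"
    using tree_arcs_triangle_free[OF assms(1), of x y z] ac by (auto simp: P_def)
  then show "a \<in> P \<union> rot ` P \<union> (rot \<circ> rot) ` P"
  proof cases
    case 2
    then have "(rot \<circ> rot) (y, z) \<in> (rot \<circ> rot) ` P" by blast
    then show ?thesis using r a by simp
  next
    case 3
    then have "rot (z, x) \<in> rot ` P" by blast
    then show ?thesis using r a by simp
  qed (use a in simp)
qed

text \<open>The second claim shows that the subtraction in the first is not truncated.\<close>

lemma card_non_tree_arcs:
  assumes "level_forest R lev par"
  shows "card (arcs - tree_arcs R par) = 2 * card (edges G) - 2 * (card (verts G) - card R)"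
    and "2 * (card (verts G) - card R) \<le> 2 * card (edges G)"
proof -
  note sub = tree_arcs_subset[OF assms]
  show "card (arcs - tree_arcs R par) = 2 * card (edges G) - 2 * (card (verts G) - card R)"
    using card_Diff_subset[OF finite_subset[OF sub finite_arcs] sub]
    by (simp add: card_arcs card_tree_arcs[OF assms])
  show "2 * (card (verts G) - card R) \<le> 2 * card (edges G)"
    using card_mono[OF finite_arcs sub] by (simp add: card_arcs card_tree_arcs[OF assms])
qed

text \<open>In undirected terms: there are at most as many triangles as edges outside the
  forest.\<close>

lemma card_triangle_arcs_le:
  assumes "level_forest R lev par"
  shows "card (arcs \<inter> covered) \<le> 3 * card (arcs - tree_arcs R par)"
proof -
  let ?P = "(arcs - tree_arcs R par) \<inter> covered"
  have fin: "finite ?P" by (simp add: finite_arcs)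
  have "card (arcs \<inter> covered) \<le> card (?P \<union> rot ` ?P \<union> (rot \<circ> rot) ` ?P)"
    using triangle_arcs_cover[OF assms] fin by (intro card_mono) auto
  also have "\<dots> \<le> card ?P + card ?P + card ?P"
    by (rule card_Un3_image_le[OF fin fin fin])
  also have "\<dots> \<le> 3 * card (arcs - tree_arcs R par)"
    using card_mono[of "arcs - tree_arcs R par" ?P] finite_arcs by simp
  finally show ?thesis .
qed

text \<open>Equality leaves no slack in the cover by \<open>P\<close> and its two rotations: every
  non-tree arc lies in a triangle, and it is the only non-tree arc of its \<open>rot\<close>
  orbit.\<close>

lemma non_tree_arc_in_triangle:
  assumes forest: "level_forest R lev par"
    and eq: "card (arcs \<inter> covered) = 3 * card (arcs - tree_arcs R par)"
    and xy: "(x, y) \<in> arcs - tree_arcs R par"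
  obtains z where "(y, z) \<in> tree_arcs R par" "(z, x) \<in> tree_arcs R par"
proof -
  let ?U = "arcs - tree_arcs R par"
  define P where "P = ?U \<inter> covered"
  have fin: "finite ?U" "finite P" by (simp_all add: finite_arcs P_def)
  note cover = triangle_arcs_cover[OF forest, folded P_def]
  have "3 * card ?U \<le> card (P \<union> rot ` P \<union> (rot \<circ> rot) ` P)"
    unfolding eq[symmetric] using cover fin by (intro card_mono) auto
  also have "\<dots> \<le> card P + card P + card P"
    by (rule card_Un3_image_le) (use fin in auto)
  finally have "card ?U \<le> card P" by simp
  then have PU: "P = ?U" using fin by (intro card_seteq) (auto simp: P_def)
  have xyP: "(x, y) \<in> P" using xy PU by simp
  then obtain z where z: "x \<noteq> y" "adj x y" "adj x z" "adj y z"
    by (auto simp: P_def covered_def arcs_def)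
  have ne: "y \<noteq> z" "z \<noteq> x" using z adjD(3) by blast+
  have sym: "adj y x" "adj z x" "adj z y" using z by (simp_all add: insert_commute)
  have r: "rot (x, y) = (y, z)" "rot (y, z) = (z, x)"
    using ne sym z by (auto intro!: rot_eq)
  have less: "card (P - {(x, y)}) < card P"
    using xyP fin by (intro psubset_card_mono) auto
  \<comment> \<open>If a rotation sends \<open>(x, y)\<close> back into \<open>P\<close>, then
    \<open>(x, y)\<close> can be omitted from that image, and the cover becomes too small.\<close>
  have drop: "f ` P \<subseteq> P \<union> f ` (P - {(x, y)})" if "f (x, y) \<in> P" for f
  proof (rule image_subsetI)
    fix c assume "c \<in> P"
    then show "f c \<in> P \<union> f ` (P - {(x, y)})" using that by (cases "c = (x, y)") simp_all
  qed
  have "(y, z) \<notin> P"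
  proof
    assume "(y, z) \<in> P"
    then have "rot ` P \<subseteq> P \<union> rot ` (P - {(x, y)})"
      by (intro drop) (simp add: r)
    then have "arcs \<inter> covered \<subseteq> P \<union> rot ` (P - {(x, y)}) \<union> (rot \<circ> rot) ` P"
      using cover by blast
    then have "card (arcs \<inter> covered) \<le> card (P \<union> rot ` (P - {(x, y)}) \<union> (rot \<circ> rot) ` P)"
      using fin by (intro card_mono) auto
    also have "\<dots> \<le> card P + card (P - {(x, y)}) + card P"
      by (rule card_Un3_image_le) (use fin in auto)
    finally show False using less eq arg_cong[OF PU, of card] by linarith
  qed
  moreover have "(z, x) \<notin> P"
  proof
    assume "(z, x) \<in> P"
    then have "(rot \<circ> rot) ` P \<subseteq> P \<union> (rot \<circ> rot) ` (P - {(x, y)})"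
      by (intro drop) (simp add: r)
    then have "arcs \<inter> covered \<subseteq> P \<union> rot ` P \<union> (rot \<circ> rot) ` (P - {(x, y)})"
      using cover by blast
    then have "card (arcs \<inter> covered) \<le> card (P \<union> rot ` P \<union> (rot \<circ> rot) ` (P - {(x, y)}))"
      using fin by (intro card_mono) auto
    also have "\<dots> \<le> card P + card P + card (P - {(x, y)})"
      by (rule card_Un3_image_le) (use fin in auto)
    finally show False using less eq arg_cong[OF PU, of card] by linarith
  qed
  ultimately have "(y, z) \<in> tree_arcs R par" "(z, x) \<in> tree_arcs R par"
    unfolding PU using z sym by (simp_all add: arcs_def)
  then show ?thesis by (rule that)
qed

section \<open>Connected components and distant pairs\<close>

lemma arcs_rtrancl_sym: "(x, y) \<in> arcs\<^sup>* \<Longrightarrow> (y, x) \<in> arcs\<^sup>*"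
proof -
  have "sym arcs" by (auto simp: sym_def arcs_def insert_commute)
  then show "(x, y) \<in> arcs\<^sup>* \<Longrightarrow> (y, x) \<in> arcs\<^sup>*" by (meson sym_rtrancl symD)
qed

text \<open>A smallest set reaching all vertices has one vertex per component. Levels are distances
  from it, and a parent is the penultimate vertex of a shortest walk.\<close>

lemma spanning_level_forest:
  obtains R lev par where "level_forest R lev par"
    and "\<And>r s. r \<in> R \<Longrightarrow> s \<in> R \<Longrightarrow> (r, s) \<in> arcs\<^sup>* \<Longrightarrow> r = s"
    and "verts G \<subseteq> arcs\<^sup>* `` R"
proof -
  define good where "good R \<longleftrightarrow> R \<subseteq> verts G \<and> verts G \<subseteq> arcs\<^sup>* `` R" for R
  have "good (verts G)" by (auto simp: good_def)
  then obtain R where R: "good R" "\<And>S. good S \<Longrightarrow> card R \<le> card S"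
    using ex_has_least_nat[of good "verts G" card] by blast
  have finR: "finite R" using R(1) finite_verts[OF simple] by (auto simp: good_def intro: finite_subset)
  have indep: "r = s" if rs: "r \<in> R" "s \<in> R" "(r, s) \<in> arcs\<^sup>*" for r s
  proof (rule ccontr)
    assume "r \<noteq> s"
    have "verts G \<subseteq> arcs\<^sup>* `` (R - {s})"
    proof
      fix w assume "w \<in> verts G"
      then obtain t where t: "t \<in> R" "(t, w) \<in> arcs\<^sup>*" using R(1) by (auto simp: good_def)
      show "w \<in> arcs\<^sup>* `` (R - {s})"
      proof (cases "t = s")
        case True
        then have "(r, w) \<in> arcs\<^sup>*" using t rs by auto
        then show ?thesis using rs \<open>r \<noteq> s\<close> by blast
      qed (use t in blast)
    qed
    then have "good (R - {s})" using R(1) by (auto simp: good_def)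
    moreover have "card (R - {s}) < card R" using rs finR by (intro psubset_card_mono) auto
    ultimately show False using R(2) by force
  qed
  define lev where "lev w = (LEAST k. \<exists>r\<in>R. (r, w) \<in> arcs ^^ k)" for w
  have "\<exists>u. adj w u \<and> lev u < lev w" if w: "w \<in> verts G - R" for w
  proof -
    obtain t where "t \<in> R" "(t, w) \<in> arcs\<^sup>*" using R(1) w by (auto simp: good_def)
    then have "\<exists>k. \<exists>r\<in>R. (r, w) \<in> arcs ^^ k" by (meson rtrancl_power)
    then have "\<exists>r\<in>R. (r, w) \<in> arcs ^^ lev w" unfolding lev_def by (rule LeastI_ex)
    then obtain r where r: "r \<in> R" "(r, w) \<in> arcs ^^ lev w" by blast
    then have "lev w \<noteq> 0" using w by (auto intro: ccontr)
    then obtain j where j: "lev w = Suc j" by (cases "lev w") auto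
    then obtain u where u: "(r, u) \<in> arcs ^^ j" "(u, w) \<in> arcs" using r by auto
    have "lev u \<le> j" unfolding lev_def using r u by (intro Least_le) blast
    then show ?thesis using u j by (auto simp: arcs_def insert_commute)
  qed
  then obtain par where "\<forall>w\<in>verts G - R. adj w (par w) \<and> lev (par w) < lev w" by metis
  then have "level_forest R lev par" using R(1) by (auto simp: level_forest_def good_def)
  then show ?thesis using that indep R(1) by (auto simp: good_def)
qed

text \<open>Every component contains its root and a neighbour of it. Pairing the two vertices of one
  component with the two of each other component, in both orders, gives 8 far pairs per other
  component.\<close>

lemma card_far_ge:
  assumes R: "R \<subseteq> verts G" "R \<noteq> {}"
    and indep: "\<And>r s. r \<in> R \<Longrightarrow> s \<in> R \<Longrightarrow> (r, s) \<in> arcs\<^sup>* \<Longrightarrow> r = s"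
    and no_iso: "\<And>v. v \<in> verts G \<Longrightarrow> \<exists>w. adj v w"
  shows "8 * (card R - 1) \<le> card far"
proof -
  obtain nb where nb: "\<And>v. v \<in> verts G \<Longrightarrow> adj v (nb v)" using no_iso by metis
  have nbR: "(r, nb r) \<in> arcs\<^sup>*" "(nb r, r) \<in> arcs\<^sup>*" "nb r \<noteq> r" "nb r \<in> verts G"
    if "r \<in> R" for r
  proof -
    have "adj r (nb r)" using nb that R by auto
    then show "(r, nb r) \<in> arcs\<^sup>*" "(nb r, r) \<in> arcs\<^sup>*" "nb r \<noteq> r" "nb r \<in> verts G"
      using adjD[of r "nb r"] by (auto simp: arcs_def insert_commute intro!: r_into_rtrancl)
  qed
  have finR: "finite R" using R finite_verts[OF simple] by (auto intro: finite_subset)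
  obtain r where r: "r \<in> R" using R by blast
  define S0 where "S0 = R - {r}"
  define S where "S = S0 \<union> nb ` S0"
  define T where "T = {r, nb r}"
  have "inj_on nb S0"
  proof (rule inj_onI)
    fix s t assume st: "s \<in> S0" "t \<in> S0" "nb s = nb t"
    then have "(s, t) \<in> arcs\<^sup>*"
      using nbR(1)[of s] nbR(2)[of t] by (auto simp: S0_def)
    then show "s = t" using st indep by (auto simp: S0_def)
  qed
  moreover have "S0 \<inter> nb ` S0 = {}"
  proof -
    have False if "s \<in> S0" "t \<in> S0" "s = nb t" for s t
    proof -
      have "s = t" using that nbR(2)[of t] indep[of s t] by (auto simp: S0_def)
      then show False using that nbR(3)[of t] by (auto simp: S0_def)
    qed
    then show ?thesis by blast
  qed
  ultimately have cardS: "card S = 2 * (card R - 1)"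
    unfolding S_def using finR r by (subst card_Un_disjoint) (auto simp: card_image S0_def)
  have cardT: "card T = 2" using nbR(3)[OF r] by (auto simp: T_def card_2_iff)
  have sep: "(t, s) \<notin> arcs\<^sup>*" if ts: "t \<in> T" "s \<in> S" for t s
  proof
    assume *: "(t, s) \<in> arcs\<^sup>*"
    have 1: "(r, t) \<in> arcs\<^sup>*" using ts nbR[OF r] by (auto simp: T_def)
    obtain s0 where 2: "s0 \<in> S0" "(s, s0) \<in> arcs\<^sup>*" using ts nbR(2) by (auto simp: S_def S0_def)
    have "(r, s0) \<in> arcs\<^sup>*" using 1 2 * by (meson rtrancl_trans)
    then show False using 2 r indep by (auto simp: S0_def)
  qed
  have farI: "(x, y) \<in> far" if "x \<in> verts G" "y \<in> verts G" "(x, y) \<notin> arcs\<^sup>*" for x y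
  proof -
    have "(x, y) \<notin> covered"
    proof
      assume "(x, y) \<in> covered"
      then obtain z where "(x, z) \<in> arcs" "(z, y) \<in> arcs"
        by (auto simp: covered_def arcs_def insert_commute)
      then show False using that by (meson rtrancl.rtrancl_into_rtrancl r_into_rtrancl)
    qed
    then show ?thesis using that by (auto simp: far_def)
  qed
  have V: "T \<subseteq> verts G" "S \<subseteq> verts G" using nbR r R by (auto simp: T_def S_def S0_def)
  have "T \<times> S \<union> S \<times> T \<subseteq> far"
    using V sep arcs_rtrancl_sym by (blast intro: farI)
  then have "card (T \<times> S \<union> S \<times> T) \<le> card far" by (intro card_mono finite_far)
  moreover have "T \<inter> S = {}" using sep by auto
  then have "card (T \<times> S \<union> S \<times> T) = 2 * (card T * card S)"
    using V finite_verts[OF simple] by (subst card_Un_disjoint) (auto intro: finite_subset simp: card_cartesian_product)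
  ultimately show ?thesis using cardS cardT by simp
qed

section \<open>The extremal inequality and its equality case\<close>

text \<open>With k roots, the triangle bound leaves an excess of at most
  \<open>6 * (k - 1) - card far\<close> over the claimed value, hence at most
  \<open>- 2 * (k - 1)\<close>. Equality forces k = 1 and then \<open>far = {}\<close>.\<close>

lemma excess_le:
  assumes ne: "verts G \<noteq> {}" and no_iso: "\<And>v. v \<in> verts G \<Longrightarrow> \<exists>w. adj v w"
  shows "excess G \<le> (int (card (verts G)) - 2) * (int (card (verts G)) - 3)"
    and "excess G = (int (card (verts G)) - 2) * (int (card (verts G)) - 3) \<Longrightarrow>
      far = {} \<and>
      int (card (arcs \<inter> covered)) = 6 * int (card (edges G)) - 6 * (int (card (verts G)) - 1)"
proof -
  obtain R lev par where R: "level_forest R lev par"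
    "\<And>r s. r \<in> R \<Longrightarrow> s \<in> R \<Longrightarrow> (r, s) \<in> arcs\<^sup>* \<Longrightarrow> r = s" "verts G \<subseteq> arcs\<^sup>* `` R"
    by (rule spanning_level_forest) blast
  have sub: "R \<subseteq> verts G" "R \<noteq> {}" using R ne by (auto simp: level_forest_def)
  have finR: "finite R" using sub finite_verts[OF simple] by (auto intro: finite_subset)
  then have R1: "1 \<le> card R" using sub by (simp add: Suc_leI card_gt_0_iff)
  have Rn: "card R \<le> card (verts G)" using sub finite_verts[OF simple] by (intro card_mono)
  have f: "8 * (int (card R) - 1) \<le> int (card far)"
  proof -
    have "8 * (card R - 1) \<le> card far" using R(2) no_iso by (intro card_far_ge[OF sub]) blast+
    then show ?thesis using R1 by (cases "card R") auto
  qed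
  have t: "int (card (arcs \<inter> covered)) \<le>
      6 * int (card (edges G)) - 6 * int (card (verts G)) + 6 * int (card R)"
    using card_triangle_arcs_le[OF R(1)] card_non_tree_arcs[OF R(1)] Rn by linarith
  have R1': "1 \<le> int (card R)" using R1 by simp
  \<comment> \<open>Hides the nonlinear product from linear arithmetic.\<close>
  define B where "B = (int (card (verts G)) - 2) * (int (card (verts G)) - 3)"
  note e = excess_eq[OF ne, folded B_def]
  show "excess G \<le> (int (card (verts G)) - 2) * (int (card (verts G)) - 3)"
    unfolding B_def[symmetric] using e f t R1' by presburger
  assume "excess G = (int (card (verts G)) - 2) * (int (card (verts G)) - 3)"
  then have B: "excess G = B" by (simp add: B_def)
  have "int (card R) = 1" using B e f t R1' by presburger
  then have "int (card far) = 0" using B e f t by presburger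
  then show "far = {} \<and>
      int (card (arcs \<inter> covered)) = 6 * int (card (edges G)) - 6 * (int (card (verts G)) - 1)"
    using B e finite_far by auto
qed

text \<open>\<open>tri\<close> is equality in \<open>card_triangle_arcs_le\<close> for every forest
  with a single root, so the root may be chosen freely: here, of maximum degree.\<close>

lemma universal_vertex_if_extremal:
  assumes ne: "verts G \<noteq> {}" and far: "far = {}"
    and tri: "int (card (arcs \<inter> covered)) = 6 * int (card (edges G)) - 6 * (int (card (verts G)) - 1)"
  obtains v where "v \<in> verts G" "\<And>w. w \<in> verts G \<Longrightarrow> w \<noteq> v \<Longrightarrow> adj v w"
proof -
  have fin: "finite (degree G ` verts G)" using finite_verts[OF simple] by simp
  obtain v where v: "v \<in> verts G" "degree G v = Max (degree G ` verts G)"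
    using Max_in[OF fin] ne by (metis image_iff image_is_empty)
  have vmax: "degree G w \<le> degree G v" if "w \<in> verts G" for w
    unfolding v(2) using that fin by (intro Max_ge) auto
  have common: "\<exists>z. adj x z \<and> adj y z" if "x \<in> verts G" "y \<in> verts G" "x \<noteq> y" "\<not> adj x y" for x y
    using far that by (auto simp: far_def arcs_def covered_def)
  \<comment> \<open>Breadth-first levels from \<open>v\<close>; \<open>far = {}\<close> makes 2 the
    last level and supplies a parent for each vertex on it.\<close>
  define lev where "lev w = (if w = v then 0 else if adj v w then 1 else 2 :: nat)" for w
  define par where "par w = (if adj v w then v else SOME z. adj v z \<and> adj w z)" for w
  have par2: "adj v (par w) \<and> adj w (par w)" if "w \<in> verts G" "w \<noteq> v" "\<not> adj v w" for w
    using someI_ex[OF common[of v w]] that v by (simp add: par_def)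
  have par1: "par w = v" if "adj v w" for w using that by (simp add: par_def)
  have forest: "level_forest {v} lev par"
    unfolding level_forest_def
  proof (intro conjI ballI)
    fix w assume w: "w \<in> verts G - {v}"
    show "adj w (par w)" using w par1 par2 by (cases "adj v w") (auto simp: insert_commute)
    show "lev (par w) < lev w"
    proof (cases "adj v w")
      case True
      then show ?thesis using w by (simp add: par1 lev_def)
    next
      case False
      then have "adj v (par w)" using par2 w by simp
      then show ?thesis using w False adjD(3) by (auto simp: lev_def)
    qed
  qed (use v in simp)
  have eq: "card (arcs \<inter> covered) = 3 * card (arcs - tree_arcs {v} par)"
    using tri card_non_tree_arcs[OF forest] v card_gt_0_iff[of "verts G"] ne finite_verts[OF simple]
    by simp
  \<comment> \<open>Parents are \<open>v\<close> or neighbours of \<open>v\<close>, so a level 2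
    vertex has no children and its only tree arc leads to its parent.\<close>
  have tree: "b = par z" if "(z, b) \<in> tree_arcs {v} par" "z \<noteq> v" "\<not> adj v z" for z b
  proof -
    have "b = par z \<or> (z = par b \<and> b \<in> verts G \<and> b \<noteq> v)"
      using that(1) by (auto simp: tree_arcs_def)
    then show ?thesis using that par1[of b] par2[of b] by metis
  qed
  have tree_sym: "(z, b) \<in> tree_arcs {v} par \<Longrightarrow> (b, z) \<in> tree_arcs {v} par" for z b
    by (auto simp: tree_arcs_def)
  \<comment> \<open>If \<open>b\<close> were at distance 2 from \<open>v\<close> via \<open>a\<close>, then \<open>a\<close> would have larger degree than \<open>v\<close>.\<close>
  have "adj v b" if b: "b \<in> verts G" "b \<noteq> v" for b
  proof (rule ccontr)
    assume nb: "\<not> adj v b"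
    obtain a where a: "adj v a" "adj b a" using common[of v b] b v nb by auto
    \<comment> \<open>Otherwise \<open>b\<close> and \<open>a'\<close> have a common neighbour
      \<open>c\<close> at level 2. The non-tree arc \<open>(b, c)\<close> closes a triangle with the
      common parent \<open>z\<close> of \<open>b\<close> and \<open>c\<close>; uniqueness of common
      neighbours with \<open>v\<close> yields both \<open>z = a\<close> and
      \<open>z = a'\<close>.\<close>
    have near: "adj a a'" if a': "adj v a'" "a' \<noteq> a" for a'
    proof (rule ccontr)
      assume na: "\<not> adj a a'"
      have "\<not> adj b a'" using c4_free[of v b a a'] a a' b by blast
      moreover have "b \<noteq> a'" "a' \<in> verts G" using nb a' adjD by auto
      ultimately obtain c where c: "adj b c" "adj a' c" using common[of b a'] b by blast
      have cv: "c \<noteq> v" using c nb by (auto simp: insert_commute)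
      have nc: "\<not> adj v c"
      proof
        assume "adj v c"
        then have "a = c" using c4_free[of v b a c] a c b by blast
        then show False using c na by (simp add: insert_commute)
      qed
      have cV: "c \<in> verts G" using c adjD by blast
      have "(b, c) \<notin> tree_arcs {v} par"
      proof
        assume "(b, c) \<in> tree_arcs {v} par"
        then have "c = par b" using tree b nb by blast
        then show False using par2[of b] b nb nc by auto
      qed
      then have "(b, c) \<in> arcs - tree_arcs {v} par" using c by (simp add: arcs_def)
      then obtain z where z: "(c, z) \<in> tree_arcs {v} par" "(z, b) \<in> tree_arcs {v} par"
        using non_tree_arc_in_triangle[OF forest eq] by blast
      have "z = par c" using tree[OF z(1) cv nc] .
      then have zc: "adj v z" "adj c z" using par2[of c] cV cv nc by auto
      have "z = par b" using tree[OF tree_sym[OF z(2)]] b nb by blast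
      then have zb: "adj b z" using par2[of b] b nb by auto
      have "z = a" using c4_free[of v b z a] zc zb a b by blast
      moreover have "z = a'"
        using c4_free[of v c z a'] zc a' c cv by (metis insert_commute)
      ultimately show False using a' by simp
    qed
    \<comment> \<open>Passing from the neighbours of \<open>v\<close> to those of \<open>a\<close>
      loses at most \<open>a\<close> and gains \<open>v\<close> and \<open>b\<close>.\<close>
    have "insert v (insert b (nbrs G v - {a})) \<subseteq> nbrs G a"
      using near a by (auto simp: nbrs_def insert_commute)
    then have "card (insert v (insert b (nbrs G v - {a}))) \<le> card (nbrs G a)"
      by (intro card_mono finite_nbrs[OF simple])
    moreover have "v \<notin> nbrs G v" "b \<notin> nbrs G v" "a \<in> nbrs G v"
      using nb a adjD(3)[of v v] by (auto simp: nbrs_def)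
    moreover have "finite (nbrs G v)" by (rule finite_nbrs[OF simple])
    ultimately have "Suc (card (nbrs G v)) \<le> card (nbrs G a)"
      using b card_Suc_Diff1[of "nbrs G v" a] by simp
    moreover have "card (nbrs G a) \<le> card (nbrs G v)"
      using vmax[of a] a adjD(2)[of v a] by (simp add: degree_eq_card_nbrs[OF simple])
    ultimately show False by simp
  qed
  then show ?thesis using that v by blast
qed

text \<open>The edges avoiding \<open>v\<close> form a matching: two of them meeting in
  \<open>x\<close> would give \<open>x\<close> and \<open>v\<close> two common neighbours. Their
  number leaves at most one leaf unmatched.\<close>

lemma graph_iso_friendship_graph:
  assumes v: "v \<in> verts G" "\<And>w. w \<in> verts G \<Longrightarrow> w \<noteq> v \<Longrightarrow> adj v w"
    and n: "card (verts G) = n" and m: "card (edges G) = 3 * (n - 1) div 2"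
  shows "graph_iso G (friendship_graph n)"
proof -
  let ?F = "friendship_graph n"
  define L where "L = verts G - {v}"
  define M where "M = {e \<in> edges G. v \<notin> e}"
  define q where "q = (n - 1) div 2"
  have finV: "finite (verts G)" by (rule finite_verts[OF simple])
  have finE: "finite (edges G)" by (rule finite_edges[OF simple])
  have n1: "n \<ge> 1" using v(1) n finV by (metis One_nat_def Suc_leI card_gt_0_iff empty_iff)
  have cardL: "card L = n - 1" using v n finV by (simp add: L_def)
  have "nbrs G v = L" using v nbrs_subset[OF simple, of v] by (auto simp: nbrs_def L_def)
  then have "degree G v = n - 1" using cardL by (simp add: degree_eq_card_nbrs[OF simple])
  moreover have "card (edges G) = card {e \<in> edges G. v \<in> e} + card M"
    unfolding M_def using finE by (subst card_Un_disjoint[symmetric]) (auto intro: arg_cong[of _ _ card])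
  ultimately have cardM: "card M = q" using m by (simp add: degree_def q_def)
  have finM: "finite M" using finE by (simp add: M_def)
  have M2: "card e = 2" "e \<subseteq> L" if "e \<in> M" for e
    using that simple by (auto simp: M_def L_def simple_graph_def)
  have Mdisj: "e \<inter> e' = {}" if e: "e \<in> M" "e' \<in> M" "e \<noteq> e'" for e e'
  proof (rule ccontr)
    assume "e \<inter> e' \<noteq> {}"
    then obtain x where x: "x \<in> e" "x \<in> e'" by blast
    obtain y where y: "e = {x, y}" using M2(1)[OF e(1)] x by (auto simp: card_2_iff doubleton_eq_iff)
    obtain y' where y': "e' = {x, y'}" using M2(1)[OF e(2)] x by (auto simp: card_2_iff doubleton_eq_iff)
    have "adj x y" "adj x y'" "adj v y" "adj v y'" "x \<noteq> v"
      using e y y' M2(2)[OF e(1)] M2(2)[OF e(2)] v(2) by (auto simp: M_def L_def)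
    then have "y = y'" using c4_free[of x v y y'] by blast
    then show False using y y' e by simp
  qed
  have UM: "\<Union>M \<subseteq> L" using M2 by blast
  have finL: "finite L" using finV by (simp add: L_def)
  have "2 * card M = card (\<Union>M)"
    using finM M2 Mdisj UM finL by (intro card_partition) (auto intro: finite_subset)
  then have rest: "card (L - \<Union>M) = n - 1 - 2 * q"
    using card_Diff_subset[OF finite_subset[OF UM finL] UM] cardL cardM by simp
  obtain h where h: "bij_betw h {0..<q} M" using ex_bij_betw_nat_finite[OF finM] cardM by auto
  then have "\<forall>i<q. \<exists>a b. h i = {a, b}"
    using M2(1) by (metis atLeastLessThan_iff bij_betwE card_2_iff zero_le)
  then obtain a b where ab: "\<And>i. i < q \<Longrightarrow> h i = {a i, b i}" by metis
  \<comment> \<open>The unmatched leaf if \<open>n\<close> is even. For odd \<open>n\<close> the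
    value is arbitrary, but its index \<open>2 * q + 1\<close> is then \<open>n\<close>, out of
    range.\<close>
  define w where "w = (SOME w. w \<in> L - \<Union>M)"
  \<comment> \<open>Numbering as in \<open>friendship_graph\<close>: the centre is 0, and the ends
    of the matching edge \<open>h i\<close> are \<open>2 * i + 1\<close> and
    \<open>2 * i + 2\<close>.\<close>
  define g where "g k = (if k = 0 then v else if k \<le> 2 * q
    then (if odd k then a (k div 2) else b (k div 2 - 1)) else w)" for k
  have g: "g 0 = v" "i < q \<Longrightarrow> g (2 * i + 1) = a i" "i < q \<Longrightarrow> g (2 * i + 2) = b i"
    "g (2 * q + 1) = w" for i
    by (auto simp: g_def)
  have "verts G \<subseteq> g ` {..<n}"
  proof
    fix x assume x: "x \<in> verts G"
    consider "x = v" | "x \<in> \<Union>M" | "x \<in> L - \<Union>M" using x by (auto simp: L_def)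
    then show "x \<in> g ` {..<n}"
    proof cases
      case 1
      then show ?thesis using g(1) n1 by force
    next
      case 2
      then obtain i where i: "i < q" "x \<in> h i" using h by (auto simp: bij_betw_def)
      then have "x = g (2 * i + 1) \<or> x = g (2 * i + 2)" using ab g by auto
      moreover have "2 * i + 2 < n" using i by (auto simp: q_def)
      ultimately show ?thesis by force
    next
      case 3
      then have "card (L - \<Union>M) > 0" using finL by (auto simp: card_gt_0_iff)
      then have c: "card (L - \<Union>M) = 1" "2 * q + 1 < n" using rest by (auto simp: q_def)
      have "w \<in> L - \<Union>M" unfolding w_def using 3 by (rule someI)
      then have "x = w" using c(1) 3 by (metis card_1_singletonE singletonD)
      then show ?thesis using g(4) c(2) by force
    qed
  qed
  moreover have "card (g ` {..<n}) \<le> n" using card_image_le[of "{..<n}" g] by simp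
  ultimately have im: "verts G = g ` {..<n}" using n by (intro card_seteq) auto
  then have inj: "inj_on g {..<n}" using n by (intro eq_card_imp_inj_on) auto
  have bij: "bij_betw g {..<n} (verts G)" using im inj by (simp add: bij_betw_def)
  have VF: "verts ?F = {..<n}" by (simp add: friendship_graph_def star_graph_def)
  have EF: "edges ?F \<subseteq> Pow {..<n}"
    using simple_graph_friendship_graph[of n] by (auto simp: simple_graph_def VF)
  have injP: "inj_on (image g) (Pow {..<n})" by (rule inj_on_image_Pow[OF inj])
  \<comment> \<open>One inclusion suffices, as the edge counts agree and \<open>image g\<close> is
    injective on edges.\<close>
  have "image g ` edges ?F \<subseteq> edges G"
  proof
    fix e assume "e \<in> image g ` edges ?F"
    then consider k where "k \<in> {1..<n}" "e = g ` {0, k}"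
      | i where "2 * i + 2 < n" "e = g ` {2 * i + 1, 2 * i + 2}"
      by (auto simp: friendship_graph_def star_graph_def leaf_matching_def)
    then show "e \<in> edges G"
    proof cases
      case 1
      have "g k \<in> verts G" using im 1 by auto
      moreover have "g k \<noteq> g 0" using inj_onD[OF inj, of k 0] 1(1) by auto
      ultimately show ?thesis using v(2) 1 g(1) by simp
    next
      case 2
      then have "i < q" by (auto simp: q_def)
      then have "e = h i" "h i \<in> M" using 2 ab g h by (auto simp: bij_betw_def)
      then show ?thesis by (simp add: M_def)
    qed
  qed
  moreover have "card (image g ` edges ?F) = card (edges G)"
    using inj_on_subset[OF injP EF] m by (simp add: card_image card_edges_friendship_graph)
  ultimately have EG: "image g ` edges ?F = edges G" using finE by (intro card_subset_eq)
  let ?f = "inv_into {..<n} g"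
  have "{x, y} \<in> edges G \<longleftrightarrow> {?f x, ?f y} \<in> edges ?F" if xy: "x \<in> verts G" "y \<in> verts G" for x y
  proof -
    have f: "?f x < n" "?f y < n" "g (?f x) = x" "g (?f y) = y"
      using xy unfolding im by (metis inv_into_into lessThan_iff, metis inv_into_into lessThan_iff,
        simp_all add: f_inv_into_f)
    have "image g {?f x, ?f y} \<in> image g ` edges ?F \<longleftrightarrow> {?f x, ?f y} \<in> edges ?F"
      by (rule inj_on_image_mem_iff[OF injP]) (use f EF in auto)
    then show ?thesis using f EG by simp
  qed
  moreover have "bij_betw ?f (verts G) (verts ?F)" unfolding VF by (rule bij_betw_inv_into[OF bij])
  ultimately show ?thesis unfolding graph_iso_def by blast
qed

end

section \<open>From the forbidden subgraph to the degree power inequality\<close>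

lemma c4_free_graphI:
  assumes "simple_graph G" "\<not> contains_subgraph G (cycle_graph 4)"
  shows "c4_free_graph G"
proof
  show "simple_graph G" by fact
  fix x y u w
  assume xy: "x \<noteq> y" and e: "{x, u} \<in> edges G" "{y, u} \<in> edges G" "{x, w} \<in> edges G" "{y, w} \<in> edges G"
  show "u = w"
  proof (rule ccontr)
    assume uw: "u \<noteq> w"
    \<comment> \<open>Traverses the 4-cycle x, u, y, w.\<close>
    define f where "f i = (if i = 0 then x else if i = 1 then u else if i = 2 then y else w)" for i :: nat
    have four: "{..<4} = {0, 1, 2, 3 :: nat}" by auto
    have E: "edges (cycle_graph 4) = {{0, Suc 0}, {Suc 0, Suc (Suc 0)}, {2, 3}, {3, 0}}"
    proof -
      have "edges (cycle_graph 4) = (\<lambda>i. {i, Suc i mod 4}) ` {..<4}"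
        by (auto simp: cycle_graph_def)
      then show ?thesis unfolding four by simp
    qed
    have V: "verts (cycle_graph 4) = {0, 1, 2, 3}" by (simp add: cycle_graph_def four)
    note d = simple_graph_edgeD[OF assms(1) e(1)] simple_graph_edgeD[OF assms(1) e(2)]
      simple_graph_edgeD[OF assms(1) e(3)] simple_graph_edgeD[OF assms(1) e(4)]
    have "inj_on f (verts (cycle_graph 4))" unfolding V using d xy uw by (auto simp: inj_on_def f_def)
    moreover have "f ` verts (cycle_graph 4) \<subseteq> verts G" unfolding V using d by (auto simp: f_def)
    moreover have "\<forall>e\<in>edges (cycle_graph 4). f ` e \<in> edges G"
      unfolding E using e by (auto simp: f_def insert_commute)
    ultimately have "contains_subgraph G (cycle_graph 4)" unfolding contains_subgraph_def by blast
    then show False using assms by blast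
  qed
qed

theorem theorem1:
  fixes G :: "'a ugraph" and n m p :: nat
  assumes "p > 1"
    and "simple_graph G"
    and "card (verts G) = n" and "n \<ge> 4"
    and "card (edges G) = m"
    and "\<not> contains_subgraph G (cycle_graph 4)"
    and "min_degree G \<ge> 1"
    and "m \<le> 3 * (n - 1) div 2"
  shows "degree_power p G \<le> degree_power p (friendship_graph n) \<and>
    (degree_power p G = degree_power p (friendship_graph n) \<longleftrightarrow>
      graph_iso G (friendship_graph n))"
proof -
  interpret c4_free_graph G using assms by (intro c4_free_graphI)
  let ?F = "friendship_graph n"
  define M where "M = 3 * (n - 1) div 2"
  define k where "k = p - 2"
  have p: "p = k + 2" using assms(1) by (simp add: k_def)
  have ne: "verts G \<noteq> {}" using assms(3,4) by auto
  have deg: "1 \<le> degree G v" if "v \<in> verts G" for v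
  proof -
    have "Min (degree G ` verts G) \<le> degree G v"
      using that finite_verts[OF simple] by (intro Min_le) auto
    then show ?thesis using assms(7) by (simp add: min_degree_def)
  qed
  have no_iso: "\<exists>w. adj v w" if "v \<in> verts G" for v
  proof -
    have "nbrs G v \<noteq> {}" using deg[OF that] by (auto simp: degree_eq_card_nbrs[OF simple])
    then show ?thesis by (auto simp: nbrs_def)
  qed
  define c where "c = newton_coeff k (int n - 1)"
  define A where "A = (2::int) ^ (k + 2) - 1"
  define B where "B = (int n - 2) * (int n - 3)"
  have c: "1 \<le> c" unfolding c_def using assms(4) by (intro newton_coeff_pos) simp
  have A: "1 \<le> A" unfolding A_def using one_le_power[of "2::int" "k + 1"] by simp
  have upper: "int (degree_power p G) \<le> int n + A * (2 * int m - int n) + c * excess G"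
    using degree_power_le_excess[OF simple deg, of k] assms(3,5) by (simp only: p A_def c_def)
  have F: "int (degree_power p ?F) = int n + A * (2 * int M - int n) + c * B"
    using degree_power_friendship_graph[of n k] assms(4) by (simp only: p A_def c_def B_def M_def)
  have ex: "excess G \<le> B" using excess_le(1)[OF ne no_iso] assms(3) by (simp add: B_def)
  \<comment> \<open>The bound can fall short of the value for \<open>?F\<close> in two independent
    ways: too few edges or too small an excess.\<close>
  have "0 \<le> A * (int M - int m)" "0 \<le> c * (B - excess G)"
    using A c ex assms(8) by (simp_all add: M_def)
  then have gap: "A * (2 * int m) \<le> A * (2 * int M)" "c * excess G \<le> c * B"
    by (simp_all add: algebra_simps)
  have le: "int (degree_power p G) \<le> int (degree_power p ?F)"
    using upper F gap by (simp add: algebra_simps)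
  moreover have "graph_iso G ?F" if eq: "degree_power p G = degree_power p ?F"
  proof -
    \<comment> \<open>Equality of the totals closes both gaps at once; \<open>A\<close> and
      \<open>c\<close> are positive and cancel.\<close>
    have "A * (2 * int m) = A * (2 * int M)" "c * excess G = c * B"
      using upper[unfolded eq F] gap unfolding right_diff_distrib by linarith+
    then have mM: "m = M" and "excess G = B" using A c by simp_all
    then have "far = {} \<and>
      int (card (arcs \<inter> covered)) = 6 * int (card (edges G)) - 6 * (int (card (verts G)) - 1)"
      using assms(3) by (intro excess_le(2)[OF ne no_iso]) (simp_all add: B_def)
    then obtain v where "v \<in> verts G" "\<And>w. w \<in> verts G \<Longrightarrow> w \<noteq> v \<Longrightarrow> adj v w"
      using universal_vertex_if_extremal[OF ne] by blast
    then show ?thesis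
      using graph_iso_friendship_graph assms(3,5) mM by (simp add: M_def)
  qed
  moreover have "degree_power p G = degree_power p ?F" if "graph_iso G ?F"
    using graph_iso_degree_power[OF simple simple_graph_friendship_graph that] .
  ultimately show ?thesis by auto
qed

end
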